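(* Let $d>2$, let $\pi$ be an irreducible permutation of $\{1,\dots,d\}$, and let $T:[0,1)\to[0,1)$ be a $d$-interval exchange transformation with permutation $\pi$ which is ergodic with respect to the Lebesgue measure $\lambda$ on $[0,1)$. Let $\{b_i\}_{i=1}^{\infty}$ be a decreasing sequence of positive real numbers with $\sum_{i=1}^{\infty} b_i=\infty$. Then for almost every $\alpha\in[0,1)$ and almost every $x\in[0,1)$ (that is, for $\lambda$-almost every $\alpha$, for $\lambda$-almost every $x$), $$\lambda\left(\bigcap_{n=1}^{\infty}\bigcup_{i=n}^{\infty} T^{-i}\big(B(R_\alpha^i x,b_i)\big)\right)=1.$$
   Context: Interval exchange transformation (IET) on $[0,1)$: let $P=(p_1,\dots,p_d)$ with $p_i\ge 0$ and $\sum_{i=1}^d p_i=1$, and let $I_1=[0,p_1)$, $I_2=[p_1,p_1+p_2)$, ..., $I_d=[p_1+\dots+p_{d-1},1)$. For a permutation $\pi$ of $\{1,\dots,d\}$, the $d$-IET with data $(P,\pi)$ is the map $T:[0,1)\to[0,1)$ given, for $x\in I_j$, by $T(x)=x-\sum_{t<j}p_t+\sum_{\pi(t')<\pi(j)}p_{t'}$. The permutation $\pi$ is irreducible if $\pi(\{1,\dots,t\})\ne\{1,\dots,t\}$ for every $1\le t<d$. For $\alpha\in[0,1)$, $R_\alpha:[0,1)\to[0,1)$ is the rotation $R_\alpha(x)=x+\alpha-\lfloor x+\alpha\rfloor$. $B(x,r)=\{y\in[0,1):|y-x|<r\}$ is the ball of radius $r$ centered at $x\in[0,1)$. $\lambda$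 is Lebesgue measure on $[0,1)$. $T^{-i}(A)$ denotes the preimage of $A$ under $T^i$. *)

theory Defs
  imports "HOL-Analysis.Analysis" "HOL-Combinatorics.Permutations"
begin

abbreviation unit_lebesgue :: "real measure" (\<open>\<lambda>\<^sub>I\<close>)
  where "\<lambda>\<^sub>I \<equiv> lebesgue_on {0..<1}"

section \<open>Interval exchange transformations\<close>

definition irreducible_perm :: "nat \<Rightarrow> (nat \<Rightarrow> nat) \<Rightarrow> bool"
  where "irreducible_perm d \<pi> \<longleftrightarrow>
    \<pi> permutes {1..d} \<and> (\<forall>t. 1 \<le> t \<and> t < d \<longrightarrow> \<pi> ` {1..t} \<noteq> {1..t})"

definition length_vector :: "nat \<Rightarrow> (nat \<Rightarrow> real) \<Rightarrow> bool"
  where "length_vector d p \<longleftrightarrow> (\<forall>i\<in>{1..d}. 0 \<le> p i) \<and> (\<Sum>i=1..d. p i) = 1"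

definition iet_interval :: "(nat \<Rightarrow> real) \<Rightarrow> nat \<Rightarrow> real set"
  where "iet_interval p j = {(\<Sum>t=1..<j. p t)..<(\<Sum>t=1..j. p t)}"

text \<open>
  Maps of \<open>[0,1)\<close> are represented by functions of type \<^typ>\<open>real \<Rightarrow> real\<close>, whose values outside
  \<open>[0,1)\<close> are irrelevant.  For a length vector \<open>p\<close> the intervals \<^term>\<open>iet_interval p j\<close>, \<open>1 \<le> j \<le> d\<close>,
  partition \<open>[0,1)\<close> (some may be empty), so \<open>T\<close> is determined on \<open>[0,1)\<close> by \<open>p\<close> and \<open>\<pi>\<close>.
\<close>
definition is_iet :: "nat \<Rightarrow> (nat \<Rightarrow> real) \<Rightarrow> (nat \<Rightarrow> nat) \<Rightarrow> (real \<Rightarrow> real) \<Rightarrow> bool"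
  where "is_iet d p \<pi> T \<longleftrightarrow>
    length_vector d p \<and> \<pi> permutes {1..d} \<and>
    (\<forall>j\<in>{1..d}. \<forall>x\<in>iet_interval p j.
       T x = x - (\<Sum>t=1..<j. p t) + (\<Sum>t'\<in>{t'\<in>{1..d}. \<pi> t' < \<pi> j}. p t'))"

section \<open>Ergodicity\<close>

definition measure_preserving_map :: "'a measure \<Rightarrow> ('a \<Rightarrow> 'a) \<Rightarrow> bool"
  where "measure_preserving_map M T \<longleftrightarrow> T \<in> measurable M M \<and> distr M M T = M"

definition ergodic_map :: "'a measure \<Rightarrow> ('a \<Rightarrow> 'a) \<Rightarrow> bool"
  where "ergodic_map M T \<longleftrightarrow>
    measure_preserving_map M T \<and>
    (\<forall>A\<in>sets M. T -` A \<inter> space M = A \<longrightarrow>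
       emeasure M A = 0 \<or> emeasure M (space M - A) = 0)"

section \<open>Rotations and balls\<close>

definition rotation :: "real \<Rightarrow> real \<Rightarrow> real"
  where "rotation \<alpha> x = x + \<alpha> - of_int \<lfloor>x + \<alpha>\<rfloor>"

text \<open>The distance is that of the interval, not of the circle: balls do not wrap around.\<close>
definition unit_ball :: "real \<Rightarrow> real \<Rightarrow> real set"
  where "unit_ball x r = {y\<in>{0..<1}. \<bar>y - x\<bar> < r}"

end

theory Submission
  imports Defs "HOL-Probability.Probability_Measure"
begin

text \<open>
  Fix \<open>y\<close> and view \<open>t\<^sub>i = T\<^sup>i y\<close> as an arbitrary sequence of targets.
  For \<open>i \<noteq> j\<close> the map \<open>(\<alpha>, x) \<mapsto> (x + i\<alpha>, x + j\<alpha>)\<close> preserves Haar measure on the two-torus, so the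
  events \<open>\<bar>t\<^sub>i - R\<^sub>\<alpha>\<^sup>i x\<bar> < b\<^sub>i\<close> in \<open>(\<alpha>, x)\<close> are pairwise independent.  Their probabilities are at least
  \<open>min b\<^sub>i (1/2)\<close> and have divergent sum, so by the pairwise independent Borel--Cantelli lemma almost
  every \<open>(\<alpha>, x)\<close> lies in infinitely many of them.  Fubini then exchanges \<open>y\<close> with \<open>(\<alpha>, x)\<close>.
\<close>

section \<open>Borel--Cantelli by second moments\<close>

text \<open>Second-moment method: for the counting sum \<open>S n\<close> with mean
  \<open>m n\<close>, pairwise independence keeps the variance below \<open>m n\<close>. By
  Chebyshev the count then stays bounded only with probability \<open>O(1 / m n)\<close>, which
  tends to 0.\<close>

lemma (in prob_space) borel_cantelli_pairwise_indep:
  fixes A :: "nat \<Rightarrow> 'a set"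
  assumes ev [measurable]: "\<And>i. A i \<in> events"
    and indep: "\<And>i j. i \<noteq> j \<Longrightarrow> prob (A i \<inter> A j) = prob (A i) * prob (A j)"
    and div: "\<not> summable (\<lambda>i. prob (A i))"
  shows "AE x in M. \<exists>\<^sub>\<infinity>i. x \<in> A i"
proof -
  define S :: "nat \<Rightarrow> 'a \<Rightarrow> real" where "S = (\<lambda>n x. \<Sum>i<n. indicator (A i) x)"
  define m where "m = (\<lambda>n. \<Sum>i<n. prob (A i))"
  have [measurable]: "S n \<in> borel_measurable M" for n
    unfolding S_def by measurable
  have int [simp]: "integrable M (indicator B :: 'a \<Rightarrow> real)" if "B \<in> events" for B
    using that by (simp add: integrable_indicator_iff emeasure_eq_measure)
  \<comment> \<open>Written this way, the second moment involves intersections of at most two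
    events, which is all that \<open>indep\<close> controls.\<close>
  have sq: "(S n x)\<^sup>2 = (\<Sum>i<n. \<Sum>j<n. indicator (A i \<inter> A j) x)" for n x
    by (simp add: S_def power2_eq_square sum_product indicator_inter_arith)
  have int_sq: "integrable M (\<lambda>x. (S n x)\<^sup>2)" for n
    unfolding sq by (intro Bochner_Integration.integrable_sum int) auto
  have int_S: "integrable M (S n)" for n
    unfolding S_def by (intro Bochner_Integration.integrable_sum int) auto
  have exp_S: "expectation (S n) = m n" for n
    unfolding S_def m_def by (subst Bochner_Integration.integral_sum) auto
  have exp_sq: "expectation (\<lambda>x. (S n x)\<^sup>2) \<le> (m n)\<^sup>2 + m n" for n
  proof -
    have "expectation (\<lambda>x. (S n x)\<^sup>2) = (\<Sum>i<n. \<Sum>j<n. prob (A i \<inter> A j))"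
      unfolding sq
      by (subst Bochner_Integration.integral_sum, (intro Bochner_Integration.integrable_sum int; simp))
        (intro sum.cong refl, subst Bochner_Integration.integral_sum, (intro int; simp), simp)
    \<comment> \<open>Off the diagonal this is an equality by \<open>indep\<close>; on the diagonal
      \<open>A i \<inter> A i\<close> is \<open>A i\<close>, and the extra summand
      \<open>prob (A i)\<close> absorbs it.\<close>
    also have "\<dots> \<le> (\<Sum>i<n. \<Sum>j<n. prob (A i) * prob (A j) + (if j = i then prob (A i) else 0))"
      by (intro sum_mono) (auto simp: indep)
    also have "\<dots> = (m n)\<^sup>2 + m n"
      by (simp add: sum.distrib m_def power2_eq_square sum_product)
    finally show ?thesis .
  qed
  have var: "variance (S n) \<le> m n" for n
    using variance_eq[OF int_S int_sq] exp_sq[of n] by (simp add: exp_S)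
  have m_lim: "filterlim m at_top sequentially"
    unfolding filterlim_at_top_dense
  proof
    fix Z
    have "\<exists>n. Z < m n"
    proof (rule ccontr)
      assume "\<not> ?thesis"
      then have "summable (\<lambda>i. prob (A i))"
        by (intro summableI_nonneg_bounded[where x = Z]) (auto simp: m_def not_less)
      with div show False ..
    qed
    then obtain n where "Z < m n" ..
    moreover have "m n \<le> m k" if "n \<le> k" for k
      unfolding m_def using that by (intro sum_mono2) auto
    ultimately show "\<forall>\<^sub>F k in sequentially. Z < m k"
      unfolding eventually_sequentially by (meson less_le_trans)
  qed
  have "AE x in M. \<exists>i\<ge>N. x \<in> A i" for N
  proof -
    define E where "E = {x \<in> space M. \<forall>i\<ge>N. x \<notin> A i}"
    have [measurable]: "E \<in> events"
      unfolding E_def by measurable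
    \<comment> \<open>On \<open>E\<close> only the indices below \<open>N\<close> can contribute to
      the count, however large \<open>n\<close> is.\<close>
    have S_le: "S n x \<le> N" if "x \<in> E" for n x
    proof -
      have "S n x = (\<Sum>i\<in>{..<n} \<inter> {..<N}. indicator (A i) x)"
        unfolding S_def using that by (intro sum.mono_neutral_right)
          (force simp: E_def indicator_def not_less[symmetric])+
      also have "\<dots> \<le> (\<Sum>i\<in>{..<n} \<inter> {..<N}. 1)"
        by (intro sum_mono) (auto simp: indicator_def)
      also have "\<dots> \<le> N"
        using card_mono[of "{..<N}" "{..<n} \<inter> {..<N}"] by simp
      finally show ?thesis .
    qed
    \<comment> \<open>Once \<open>m n > 2 * N\<close>, the bound \<open>S n x \<le> N\<close> puts
      every point of \<open>E\<close> at distance at least \<open>m n / 2\<close> from the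
      mean.\<close>
    have bound: "prob E \<le> 4 / m n" if "m n > 2 * N" for n
    proof -
      have pos: "m n > 0" using that by (smt (verit) of_nat_0_le_iff)
      have "prob E \<le> prob {x \<in> space M. m n / 2 \<le> \<bar>S n x - expectation (S n)\<bar>}"
      proof (intro finite_measure_mono subsetI)
        fix x assume "x \<in> E"
        with S_le[of x n] that show "x \<in> {x \<in> space M. m n / 2 \<le> \<bar>S n x - expectation (S n)\<bar>}"
          by (auto simp: exp_S E_def)
      qed measurable
      also have "\<dots> \<le> variance (S n) / (m n / 2)\<^sup>2"
        using pos by (intro Chebyshev_inequality int_sq) auto
      also have "\<dots> \<le> m n / (m n / 2)\<^sup>2"
        by (intro divide_right_mono var) auto
      also have "\<dots> = 4 / m n"
        using pos by (simp add: field_simps power2_eq_square)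
      finally show ?thesis .
    qed
    have "((\<lambda>n. 4 / m n) \<longlonglongrightarrow> 0)"
      by (intro tendsto_divide_0[OF tendsto_const] filterlim_at_top_imp_at_infinity m_lim)
    moreover have "\<forall>\<^sub>F n in sequentially. prob E \<le> 4 / m n"
      using m_lim[unfolded filterlim_at_top_dense]
      by (auto elim!: eventually_mono dest!: spec[of _ "2 * real N"] intro: bound)
    ultimately have "prob E \<le> 0"
      by (intro tendsto_lowerbound[of _ 0 sequentially]) auto
    then have "E \<in> null_sets M"
      by (auto simp: null_sets_def emeasure_eq_measure measure_le_0_iff)
    then show ?thesis
      by (rule AE_I') (auto simp: E_def)
  qed
  then have "AE x in M. \<forall>N. \<exists>i\<ge>N. x \<in> A i"
    by (simp add: AE_all_countable)
  then show ?thesis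
    by (simp add: INFM_nat_le)
qed

section \<open>Periodic integrals and affine maps of the circle\<close>

lemma nn_integral_periodic_shift:
  fixes g :: "real \<Rightarrow> ennreal"
  assumes [measurable]: "g \<in> borel_measurable borel"
    and per: "\<And>x. g (x + 1) = g x"
  shows "(\<integral>\<^sup>+x\<in>{a..<a+1}. g x \<partial>lborel) = (\<integral>\<^sup>+x\<in>{0..<1}. g x \<partial>lborel)"
proof -
  define J where "J a b = (\<integral>\<^sup>+x\<in>{a..<b}. g x \<partial>lborel)" for a b
  have per_int: "g (x + of_int k) = g x" for x k
  proof (induction k rule: int_induct[where k = 0])
    case (step1 i)
    then show ?case using per[of "x + of_int i"] by (simp add: add_ac)
  next
    case (step2 i)
    then show ?case using per[of "x + of_int i - 1"] by (simp add: algebra_simps)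
  qed auto
  have shift: "J (a + of_int k) (b + of_int k) = J a b" for a b k
    unfolding J_def
    by (subst nn_integral_real_affine[where c = 1 and t = "of_int k"])
      (auto simp: indicator_def per_int add.commute[of "of_int k"] intro!: nn_integral_cong)
  have split: "J a c = J a b + J b c" if "a \<le> b" "b \<le> c" for a b c
    unfolding J_def using that
    by (subst nn_integral_add[symmetric]) (auto simp: indicator_def intro!: nn_integral_cong)
  \<comment> \<open>Cut the window at an integer \<open>n\<close>. The piece to the left of
    \<open>n\<close>, moved right by 1, starts where the other piece ends, and the two fill
    \<open>[n, n+1)\<close>.\<close>
  define n where "n = \<lceil>a\<rceil>"
  have n: "a \<le> of_int n" "of_int n \<le> a + 1"
    unfolding n_def by linarith+
  have "J a (a + 1) = J a (of_int n) + J (of_int n) (a + 1)"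
    using n by (intro split)
  also have "J a (of_int n) = J (a + 1) (of_int n + 1)"
    using shift[of a 1 "of_int n"] by simp
  also have "\<dots> + J (of_int n) (a + 1) = J (of_int n) (of_int n + 1)"
    using n split[of "of_int n" "a + 1" "of_int n + 1"] by (simp add: add.commute)
  also have "\<dots> = J 0 1"
    using shift[of 0 n 1] by (simp add: add.commute)
  finally show ?thesis
    by (simp add: J_def)
qed

lemma nn_integral_periodic_multiple:
  fixes g :: "real \<Rightarrow> ennreal"
  assumes [measurable]: "g \<in> borel_measurable borel"
    and per: "\<And>x. g (x + 1) = g x"
  shows "(\<integral>\<^sup>+x\<in>{a..<a + real k}. g x \<partial>lborel) = of_nat k * (\<integral>\<^sup>+x\<in>{0..<1}. g x \<partial>lborel)"
proof (induction k)
  case (Suc k)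
  have "(\<integral>\<^sup>+x\<in>{a..<a + real (Suc k)}. g x \<partial>lborel) =
      (\<integral>\<^sup>+x\<in>{a..<a + real k}. g x \<partial>lborel) + (\<integral>\<^sup>+x\<in>{a + real k..<a + real k + 1}. g x \<partial>lborel)"
    by (subst nn_integral_add[symmetric]) (auto simp: indicator_def intro!: nn_integral_cong)
  also have "\<dots> = of_nat (Suc k) * (\<integral>\<^sup>+x\<in>{0..<1}. g x \<partial>lborel)"
    unfolding Suc nn_integral_periodic_shift[OF assms] by (simp add: distrib_right add.commute)
  finally show ?case .
qed simp

text \<open>Completion does not change the integral, so affine substitution in \<open>lborel\<close>
  becomes available.\<close>

lemma nn_integral_unit_lebesgue:
  "(\<integral>\<^sup>+x. f x \<partial>\<lambda>\<^sub>I) = (\<integral>\<^sup>+x\<in>{0..<1}. f x \<partial>lborel)"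
  by (simp add: nn_integral_restrict_space nn_integral_completion)

lemma borel_measurable_frac [measurable]: "frac \<in> borel_measurable (borel :: real measure)"
  unfolding frac_def by measurable

text \<open>The substitution \<open>u = c + k x\<close> stretches the unit interval over
  \<open>k\<close> full periods, and its Jacobian \<open>k\<close> cancels their number. The case
  \<open>k = 1\<close> is translation invariance.\<close>

lemma nn_integral_frac_affine:
  fixes f :: "real \<Rightarrow> ennreal"
  assumes [measurable]: "f \<in> borel_measurable borel" and "k > 0"
  shows "(\<integral>\<^sup>+x. f (frac (c + real k * x)) \<partial>\<lambda>\<^sub>I) = (\<integral>\<^sup>+x. f x \<partial>\<lambda>\<^sub>I)"
proof -
  define g where "g = (\<lambda>x. f (frac x))"
  have [measurable]: "g \<in> borel_measurable borel" unfolding g_def by measurable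
  have per: "g (x + 1) = g x" for x
    by (simp add: g_def frac_def)
  have "ennreal (real k) * (\<integral>\<^sup>+x. g (c + real k * x) \<partial>\<lambda>\<^sub>I) = (\<integral>\<^sup>+x\<in>{c..<c + real k}. g x \<partial>lborel)"
    unfolding nn_integral_unit_lebesgue
    using \<open>k > 0\<close>
    by (subst nn_integral_real_affine[where c = "real k" and t = c
          and f = "\<lambda>x. g x * indicator {c..<c + real k} x"])
      (auto simp: indicator_def zero_le_mult_iff intro!: arg_cong2[where f = "(*)"] nn_integral_cong)
  also have "\<dots> = ennreal (real k) * (\<integral>\<^sup>+x. g x \<partial>\<lambda>\<^sub>I)"
    unfolding nn_integral_unit_lebesgue
    by (subst nn_integral_periodic_multiple[where g = g, OF _ per]) (auto simp: ennreal_of_nat_eq_real_of_nat)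
  finally have "(\<integral>\<^sup>+x. g (c + real k * x) \<partial>\<lambda>\<^sub>I) = (\<integral>\<^sup>+x. g x \<partial>\<lambda>\<^sub>I)"
    using \<open>k > 0\<close> by (simp add: ennreal_mult_cancel_left)
  also have "\<dots> = (\<integral>\<^sup>+x. f x \<partial>\<lambda>\<^sub>I)"
    by (intro nn_integral_cong) (auto simp: g_def frac_eq)
  finally show ?thesis by (simp add: g_def)
qed

section \<open>Rotation orbits and pairwise independence of hits\<close>

lemma rotation_funpow:
  assumes "x \<in> {0..<1}"
  shows "(rotation \<alpha> ^^ i) x = frac (x + real i * \<alpha>)"
proof (induction i)
  case 0
  then show ?case using assms by (simp add: frac_eq)
next
  case (Suc i)
  have "(rotation \<alpha> ^^ Suc i) x = frac (frac (x + real i * \<alpha>) + \<alpha>)"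
    by (simp only: funpow.simps o_apply Suc rotation_def frac_def[of "frac _ + _"])
  then show ?case
    by (simp add: frac_add_simps(1) algebra_simps)
qed

lemma prob_space_unit_lebesgue: "prob_space \<lambda>\<^sub>I"
  by (intro prob_spaceI) (simp add: emeasure_restrict_space)

lemma measurable_unit_lebesgue_borel [measurable]: "(\<lambda>x. x) \<in> borel_measurable \<lambda>\<^sub>I"
  by (intro measurable_restrict_space1) (simp add: measurable_completion)

text \<open>Positions at two distinct times are independent and uniform. Translating
  \<open>x\<close> by \<open>i \<alpha>\<close> removes \<open>\<alpha>\<close> from the first
  factor; for fixed \<open>x\<close> the second factor then depends on \<open>\<alpha>\<close>
  through multiplication by \<open>j - i > 0\<close>, which preserves the measure.\<close>

lemma nn_integral_two_rotations:
  fixes f h :: "real \<Rightarrow> ennreal"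
  assumes [measurable]: "f \<in> borel_measurable borel" "h \<in> borel_measurable borel" and "i < j"
  shows "(\<integral>\<^sup>+z. f (frac (snd z + real i * fst z)) * h (frac (snd z + real j * fst z)) \<partial>(\<lambda>\<^sub>I \<Otimes>\<^sub>M \<lambda>\<^sub>I))
    = (\<integral>\<^sup>+x. f x \<partial>\<lambda>\<^sub>I) * (\<integral>\<^sup>+x. h x \<partial>\<lambda>\<^sub>I)"
proof -
  interpret I: prob_space "\<lambda>\<^sub>I" by (rule prob_space_unit_lebesgue)
  interpret II: pair_sigma_finite "\<lambda>\<^sub>I" "\<lambda>\<^sub>I" ..
  have shift: "(\<integral>\<^sup>+x. f (frac (x + real i * \<alpha>)) * h (frac (x + real j * \<alpha>)) \<partial>\<lambda>\<^sub>I)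
      = (\<integral>\<^sup>+x. f x * h (frac (x + real (j - i) * \<alpha>)) \<partial>\<lambda>\<^sub>I)" for \<alpha>
  proof -
    have eq: "x + real j * \<alpha> = real i * \<alpha> + x + real (j - i) * \<alpha>" for x
      using \<open>i < j\<close> by (simp add: algebra_simps)
    show ?thesis
      using nn_integral_frac_affine[of "\<lambda>u. f u * h (frac (u + real (j - i) * \<alpha>))" 1 "real i * \<alpha>"]
      by (simp add: eq frac_add_simps(1) add.commute[of _ "real i * \<alpha>"])
  qed
  have "(\<integral>\<^sup>+z. f (frac (snd z + real i * fst z)) * h (frac (snd z + real j * fst z)) \<partial>(\<lambda>\<^sub>I \<Otimes>\<^sub>M \<lambda>\<^sub>I))
      = (\<integral>\<^sup>+\<alpha>. \<integral>\<^sup>+x. f (frac (x + real i * \<alpha>)) * h (frac (x + real j * \<alpha>)) \<partial>\<lambda>\<^sub>I \<partial>\<lambda>\<^sub>I)"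
    by (subst I.nn_integral_fst[symmetric]) auto
  also have "\<dots> = (\<integral>\<^sup>+\<alpha>. \<integral>\<^sup>+x. f x * h (frac (x + real (j - i) * \<alpha>)) \<partial>\<lambda>\<^sub>I \<partial>\<lambda>\<^sub>I)"
    by (simp only: shift)
  \<comment> \<open>With \<open>\<alpha>\<close> innermost, the inner integral of \<open>h\<close>
    no longer depends on \<open>x\<close>.\<close>
  also have "\<dots> = (\<integral>\<^sup>+x. \<integral>\<^sup>+\<alpha>. f x * h (frac (x + real (j - i) * \<alpha>)) \<partial>\<lambda>\<^sub>I \<partial>\<lambda>\<^sub>I)"
    by (rule II.Fubini') measurable
  also have "\<dots> = (\<integral>\<^sup>+x. f x * (\<integral>\<^sup>+\<alpha>. h \<alpha> \<partial>\<lambda>\<^sub>I) \<partial>\<lambda>\<^sub>I)"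
    using \<open>i < j\<close> by (simp add: nn_integral_cmult nn_integral_frac_affine del: of_nat_diff)
  also have "\<dots> = (\<integral>\<^sup>+x. f x \<partial>\<lambda>\<^sub>I) * (\<integral>\<^sup>+\<alpha>. h \<alpha> \<partial>\<lambda>\<^sub>I)"
    by (rule nn_integral_multc) measurable
  finally show ?thesis .
qed

lemma AE_rotations_hit_targets:
  fixes t b :: "nat \<Rightarrow> real"
  assumes t: "\<And>i. t i \<in> {0..<1}"
    and pos: "\<And>i. i \<ge> 1 \<Longrightarrow> b i > 0"
    and div: "\<not> summable b"
  shows "AE z in \<lambda>\<^sub>I \<Otimes>\<^sub>M \<lambda>\<^sub>I. \<exists>\<^sub>\<infinity>i. \<bar>t i - frac (snd z + real i * fst z)\<bar> < b i"
proof -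
  interpret I: prob_space "\<lambda>\<^sub>I" by (rule prob_space_unit_lebesgue)
  interpret II: pair_prob_space "\<lambda>\<^sub>I" "\<lambda>\<^sub>I" ..
  define B where "B i = {y. \<bar>t i - y\<bar> < b i}" for i
  define A where "A i = {z \<in> space (\<lambda>\<^sub>I \<Otimes>\<^sub>M \<lambda>\<^sub>I). frac (snd z + real i * fst z) \<in> B i}" for i
  define q where "q i = (\<integral>\<^sup>+x. indicator (B i) x \<partial>\<lambda>\<^sub>I)" for i
  have [measurable]: "B i \<in> sets borel" for i
    unfolding B_def by measurable
  have A_sets [measurable]: "A i \<in> sets (\<lambda>\<^sub>I \<Otimes>\<^sub>M \<lambda>\<^sub>I)" for i
    unfolding A_def by measurable
  have em_A: "emeasure (\<lambda>\<^sub>I \<Otimes>\<^sub>M \<lambda>\<^sub>I) (A i) = q i" for i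
  proof -
    have "emeasure (\<lambda>\<^sub>I \<Otimes>\<^sub>M \<lambda>\<^sub>I) (A i) =
        (\<integral>\<^sup>+z. indicator (B i) (frac (snd z + real i * fst z)) * 1 \<partial>(\<lambda>\<^sub>I \<Otimes>\<^sub>M \<lambda>\<^sub>I))"
      by (simp only: nn_integral_indicator[OF A_sets, symmetric])
        (auto simp: A_def indicator_def intro!: nn_integral_cong)
    \<comment> \<open>A single event is the pair formula with constant second factor 1;
      \<open>Suc i\<close> merely supplies a later time.\<close>
    also have "\<dots> = q i"
      using nn_integral_two_rotations[of "indicator (B i)" "\<lambda>_. 1" i "Suc i"]
      using I.emeasure_space_1 by (simp add: q_def)
    finally show ?thesis .
  qed
  have em_AA: "emeasure (\<lambda>\<^sub>I \<Otimes>\<^sub>M \<lambda>\<^sub>I) (A i \<inter> A j) = q i * q j" if "i < j" for i j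
  proof -
    have "emeasure (\<lambda>\<^sub>I \<Otimes>\<^sub>M \<lambda>\<^sub>I) (A i \<inter> A j) =
        (\<integral>\<^sup>+z. indicator (B i) (frac (snd z + real i * fst z))
          * indicator (B j) (frac (snd z + real j * fst z)) \<partial>(\<lambda>\<^sub>I \<Otimes>\<^sub>M \<lambda>\<^sub>I))"
      by (simp only: nn_integral_indicator[OF sets.Int[OF A_sets A_sets], symmetric])
        (auto simp: A_def indicator_def intro!: nn_integral_cong)
    also have "\<dots> = q i * q j"
      unfolding q_def using that by (intro nn_integral_two_rotations) auto
    finally show ?thesis .
  qed
  have indep: "II.prob (A i \<inter> A j) = II.prob (A i) * II.prob (A j)" if "i \<noteq> j" for i j
  proof (cases "i < j")
    case True
    then show ?thesis by (simp add: measure_def em_A em_AA enn2real_mult)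
  next
    case False
    with that have "j < i" by simp
    then show ?thesis by (subst Int_commute) (simp add: measure_def em_A em_AA enn2real_mult)
  qed
  \<comment> \<open>Balls do not wrap around, so near an endpoint only one side of
    \<open>t i\<close> is available. The cap 1/2 ensures that an interval of length \<open>r\<close>
    fits on the side facing the farther endpoint.\<close>
  have lower: "min (b i) (1/2) \<le> II.prob (A i)" if "i \<ge> 1" for i
  proof -
    define r where "r = min (b i) (1/2)"
    have r: "0 < r" "r \<le> 1/2" "r \<le> b i" using pos[OF that] by (auto simp: r_def)
    obtain a where a: "{a<..<a+r} \<subseteq> B i \<inter> {0..<1}"
    proof (cases "t i < 1/2")
      case True
      then have "{t i<..<t i + r} \<subseteq> B i \<inter> {0..<1}"
        using t[of i] r by (auto simp: B_def)
      then show ?thesis by (rule that)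
    next
      case False
      then have "{t i - r<..<t i - r + r} \<subseteq> B i \<inter> {0..<1}"
        using t[of i] r by (auto simp: B_def)
      then show ?thesis by (rule that)
    qed
    have "ennreal r = emeasure lborel {a<..<a+r}"
      using r by simp
    also have "\<dots> \<le> emeasure lborel (B i \<inter> {0..<1})"
      using a by (intro emeasure_mono) auto
    also have "\<dots> = q i"
      by (simp add: q_def nn_integral_unit_lebesgue flip: indicator_inter_arith)
    also have "\<dots> = ennreal (II.prob (A i))"
      by (simp add: em_A[symmetric] II.emeasure_eq_measure)
    finally show ?thesis
      by (simp add: r_def ennreal_le_iff)
  qed
  have "\<not> summable (\<lambda>i. II.prob (A i))"
  proof
    assume s: "summable (\<lambda>i. II.prob (A i))"
    from summable_LIMSEQ_zero[OF s] have "\<forall>\<^sub>F i in sequentially. II.prob (A i) < 1/2"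
      by (rule order_tendstoD) simp
    \<comment> \<open>Once the probabilities are below 1/2, the minimum in \<open>lower\<close> must
      be \<open>b i\<close>. Discarding \<open>i = 0\<close> gives the positivity that removes the
      norm.\<close>
    then have "\<forall>\<^sub>F i in sequentially. norm (b i) \<le> II.prob (A i)"
      using eventually_ge_at_top[of 1]
    proof eventually_elim
      case (elim i)
      then show ?case using lower[of i] pos[of i] by auto
    qed
    then have "summable b"
      using s by (rule summable_comparison_test_ev)
    with div show False ..
  qed
  then have "AE z in \<lambda>\<^sub>I \<Otimes>\<^sub>M \<lambda>\<^sub>I. \<exists>\<^sub>\<infinity>i. z \<in> A i"
    by (intro II.borel_cantelli_pairwise_indep A_sets indep)
  then show ?thesis
    by eventually_elim (auto simp: A_def B_def elim!: INFM_mono)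
qed

section \<open>Exchange of quantifiers by Fubini\<close>

theorem corollary2p6:
  fixes d :: nat and \<pi> :: "nat \<Rightarrow> nat" and p :: "nat \<Rightarrow> real"
    and T :: "real \<Rightarrow> real" and b :: "nat \<Rightarrow> real"
  assumes "d > 2"
    and "irreducible_perm d \<pi>"
    and "is_iet d p \<pi> T"
    and "ergodic_map \<lambda>\<^sub>I T"
    and "\<And>i. i \<ge> 1 \<Longrightarrow> b i > 0"
    and "antimono_on {1..} b"
    and "filterlim (\<lambda>n. \<Sum>i=1..n. b i) at_top sequentially"
  shows "AE \<alpha> in \<lambda>\<^sub>I. AE x in \<lambda>\<^sub>I.
    emeasure \<lambda>\<^sub>I
      (\<Inter>n\<in>{1..}. \<Union>i\<in>{n..}. (T ^^ i) -` unit_ball ((rotation \<alpha> ^^ i) x) (b i) \<inter> {0..<1}) = 1"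
proof -
  interpret I: prob_space "\<lambda>\<^sub>I" by (rule prob_space_unit_lebesgue)
  interpret II: pair_prob_space "\<lambda>\<^sub>I" "\<lambda>\<^sub>I" ..
  interpret III: pair_sigma_finite "\<lambda>\<^sub>I" "\<lambda>\<^sub>I \<Otimes>\<^sub>M \<lambda>\<^sub>I" ..
  \<comment> \<open>Here \<open>z\<close> is the pair \<open>(\<alpha>, x)\<close>, in the order of
    the final quantifiers.\<close>
  define Q where "Q y z \<longleftrightarrow> (\<exists>\<^sub>\<infinity>i. \<bar>(T ^^ i) y - frac (snd z + real i * fst z)\<bar> < b i)" for y z
  have T: "T \<in> measurable \<lambda>\<^sub>I \<lambda>\<^sub>I"
    using assms(4) by (simp add: ergodic_map_def measure_preserving_map_def)
  have Ti: "T ^^ i \<in> measurable \<lambda>\<^sub>I \<lambda>\<^sub>I" for i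
  proof (induction i)
    case (Suc i)
    then show ?case using measurable_compose[OF _ T] by simp
  qed (simp add: id_def)
  have [measurable]: "T ^^ i \<in> borel_measurable \<lambda>\<^sub>I" for i
    using measurable_compose[OF Ti measurable_unit_lebesgue_borel] .
  have not_summable: "\<not> summable b"
  proof
    assume "summable b"
    \<comment> \<open>The divergent sums start at index 1 while \<open>summable\<close> counts from
      0, hence the shift.\<close>
    then have "summable (\<lambda>i. b (Suc i))"
      by (simp add: summable_Suc_iff)
    then have "(\<lambda>n. \<Sum>i<n. b (Suc i)) \<longlonglongrightarrow> (\<Sum>i. b (Suc i))"
      by (rule summable_LIMSEQ)
    moreover have "(\<Sum>i<n. b (Suc i)) = (\<Sum>i=1..n. b i)" for n
      by (induction n) auto
    ultimately show False
      using not_tendsto_and_filterlim_at_infinity[of sequentially "\<lambda>n. \<Sum>i=1..n. b i"]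
        filterlim_at_top_imp_at_infinity[OF assms(7)] by auto
  qed
  \<comment> \<open>Joint measurability in \<open>(y, (\<alpha>, x))\<close> is what permits
    swapping the two almost-everywhere quantifiers.\<close>
  have Q_sets: "{w \<in> space (\<lambda>\<^sub>I \<Otimes>\<^sub>M (\<lambda>\<^sub>I \<Otimes>\<^sub>M \<lambda>\<^sub>I)). Q (fst w) (snd w)}
      \<in> sets (\<lambda>\<^sub>I \<Otimes>\<^sub>M (\<lambda>\<^sub>I \<Otimes>\<^sub>M \<lambda>\<^sub>I))"
    unfolding Q_def INFM_nat by measurable
  \<comment> \<open>This holds for every \<open>y\<close> in the unit interval: its orbit under
    \<open>T\<close> is one admissible target sequence.\<close>
  have "AE y in \<lambda>\<^sub>I. AE z in \<lambda>\<^sub>I \<Otimes>\<^sub>M \<lambda>\<^sub>I. Q y z"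
  proof (rule AE_I2)
    fix y assume y: "y \<in> space \<lambda>\<^sub>I"
    have "(T ^^ i) y \<in> {0..<1}" for i
      using measurable_space[OF Ti y, of i] by simp
    then show "AE z in \<lambda>\<^sub>I \<Otimes>\<^sub>M \<lambda>\<^sub>I. Q y z"
      unfolding Q_def by (intro AE_rotations_hit_targets assms(5) not_summable)
  qed
  then have "AE z in \<lambda>\<^sub>I \<Otimes>\<^sub>M \<lambda>\<^sub>I. AE y in \<lambda>\<^sub>I. Q y z"
    by (subst (asm) III.AE_commute[OF Q_sets])
  then have ae: "AE \<alpha> in \<lambda>\<^sub>I. AE x in \<lambda>\<^sub>I. AE y in \<lambda>\<^sub>I. Q y (\<alpha>, x)"
    by (rule II.AE_pair)
  have full: "emeasure \<lambda>\<^sub>I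
      (\<Inter>n\<in>{1..}. \<Union>i\<in>{n..}. (T ^^ i) -` unit_ball ((rotation \<alpha> ^^ i) x) (b i) \<inter> {0..<1}) = 1"
    if x: "x \<in> space \<lambda>\<^sub>I" and Q: "AE y in \<lambda>\<^sub>I. Q y (\<alpha>, x)" for \<alpha> x
  proof -
    \<comment> \<open>The limsup set is exactly the section of \<open>Q\<close> at
      \<open>(\<alpha>, x)\<close>, because \<open>rotation_funpow\<close> identifies the ball
      centers with the \<open>frac\<close> terms.\<close>
    have "(\<Inter>n\<in>{1..}. \<Union>i\<in>{n..}. (T ^^ i) -` unit_ball ((rotation \<alpha> ^^ i) x) (b i) \<inter> {0..<1})
        = {y \<in> space \<lambda>\<^sub>I. Q y (\<alpha>, x)}" (is "?L = ?R")
    proof (intro equalityI subsetI)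
      fix y assume y: "y \<in> ?L"
      then have "\<forall>n\<ge>1. \<exists>i\<ge>n. \<bar>(T ^^ i) y - frac (x + real i * \<alpha>)\<bar> < b i"
        using x by (fastforce simp: unit_ball_def rotation_funpow)
      then have "Q y (\<alpha>, x)"
        \<comment> \<open>\<open>INFM_nat\<close> asks for \<open>i > n\<close> with
          \<open>n\<close> from 0, which matches \<open>i \<ge> Suc n\<close> with
          \<open>Suc n \<ge> 1\<close>.\<close>
        unfolding Q_def INFM_nat fst_conv snd_conv by (metis Suc_le_eq le_add1 plus_1_eq_Suc)
      with y show "y \<in> ?R" by fastforce
    next
      fix y assume y: "y \<in> ?R"
      then have "(T ^^ i) y \<in> {0..<1}" for i
        using measurable_space[OF Ti, of y i] by simp
      with y x show "y \<in> ?L"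
        by (fastforce simp: unit_ball_def rotation_funpow Q_def INFM_nat_le)
    qed
    moreover have "emeasure \<lambda>\<^sub>I ?R = 1"
    proof (rule I.emeasure_eq_1_AE)
      show "?R \<in> sets \<lambda>\<^sub>I"
        unfolding Q_def INFM_nat by measurable
      show "AE y in \<lambda>\<^sub>I. y \<in> ?R"
        using Q AE_space by eventually_elim simp
    qed
    ultimately show ?thesis by (simp only:)
  qed
  from ae show ?thesis
  proof eventually_elim
    case (elim \<alpha>)
    then show ?case
      using AE_space by eventually_elim (rule full)
  qed
qed

end
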